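(* Let $\zeta_5=e^{2\pi i/5}$ and $Y(t)=t\,\frac{1-2t+4t^2-3t^3+t^4}{1+3t+4t^2+2t^3+t^4}$. Then for all $u\in\mathbb{C}$ with $0<|u|$ sufficiently small, \[r(u^5)=\sum_{j=0}^{4} r\!\left(Y(\zeta_5^j u)\right).\]
   Context: $r(t)=\mathrm{m}\!\left((x+y+1)(x+1)(y+1)-\frac1t xy\right)$, where $\mathrm{m}(P)=\int_0^1\int_0^1\log|P(e^{2\pi i\theta_1},e^{2\pi i\theta_2})|d\theta_1d\theta_2$ is the logarithmic Mahler measure. *)

theory Defs
  imports "HOL-Analysis.Analysis"
begin

definition mahler2 :: "(complex \<Rightarrow> complex \<Rightarrow> complex) \<Rightarrow> real" where
  "mahler2 P = set_lebesgue_integral lborel ({0..1} \<times> {0..1})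
     (\<lambda>(th1::real, th2::real). ln (cmod (P (cis (2*pi*th1)) (cis (2*pi*th2)))))"

definition rfam :: "complex \<Rightarrow> real" where
  "rfam t = mahler2 (\<lambda>x y. (x + y + 1) * (x + 1) * (y + 1) - (1 / t) * x * y)"

definition Yfun :: "complex \<Rightarrow> complex" where
  "Yfun t = t * (1 - 2*t + 4*t^2 - 3*t^3 + t^4) / (1 + 3*t + 4*t^2 + 2*t^3 + t^4)"

definition zeta5 :: complex where
  "zeta5 = cis (2 * pi / 5)"

end

theory Submission
  imports Defs
begin

text \<open>
  For small \<open>t \<noteq> 0\<close>, expanding the logarithm and integrating term by term gives
  \<open>r(t) = - log |t| - Re (\<Sum>n\<ge>1. a\<^sub>n t\<^sup>n / n)\<close>, where \<open>a\<^sub>n\<close>, the constant term of the \<open>n\<close>-th power of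
  \<open>(x + y + 1) (x + 1) (y + 1) / (x y)\<close>, is the Apery number \<open>\<Sum>k. binom(n,k)\<^sup>2 binom(n+k,k)\<close>.
  The generating function \<open>f(t) = \<Sum>n. a\<^sub>n t\<^sup>n\<close> satisfies
  \<open>\<theta> ((1 - 11 t - t\<^sup>2) \<theta> f) = (3 t + t\<^sup>2) f\<close> with \<open>\<theta> = t d/dt\<close>.
  Write \<open>Y = u N / D\<close> and \<open>E = 1 - u - u\<^sup>2\<close>. Then \<open>E N D = 1 - 11 u\<^sup>5 - u\<^sup>1\<^sup>0\<close>,
  \<open>1 - 11 Y - Y\<^sup>2 = E\<^sup>5 / D\<^sup>2\<close> and \<open>Y' = E\<^sup>4 / D\<^sup>2\<close>, so \<open>f(Y) / D\<close> and \<open>f(u\<^sup>5)\<close> satisfy the same second-order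
  equation. Their Wronskian vanishes at \<open>0\<close>, hence \<open>f(Y(u)) = D(u) f(u\<^sup>5)\<close>, the degree-5 modular
  equation. After logarithmic differentiation the theorem reduces to the fact that the part of \<open>E\<^sup>5 D\<close> in
  degrees divisible by \<open>5\<close> is \<open>1 - 11 u\<^sup>5 - u\<^sup>1\<^sup>0\<close>; the constant of integration is read off at \<open>u = 0\<close>.
\<close>

section \<open>Apery numbers and their differential equation\<close>

definition apery :: "nat \<Rightarrow> nat" where
  "apery n = (\<Sum>k\<le>n. (n choose k)\<^sup>2 * (n + k choose k))"

text \<open>
  Reciprocal factorials vanish at negative integers, so that the recurrence
  below holds for all \<open>k\<close> without case distinctions at \<open>k = n\<close> or \<open>k = n + 1\<close>.
\<close>
definition inv_fact :: "int \<Rightarrow> real" where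
  "inv_fact d = (if d < 0 then 0 else 1 / fact (nat d))"

text \<open>The case \<open>d = 0\<close> works because both sides vanish. This turns index shifts
  in the recurrence into polynomial factors.\<close>

lemma inv_fact_diff_1: "inv_fact (d - 1) = of_int d * inv_fact d"
proof -
  consider "d < 0" | "d = 0" | "d > 0" by linarith
  then show ?thesis
  proof cases
    case 3
    then have "nat d = Suc (nat (d - 1))" by simp
    then have "fact (nat d) = (of_int d * fact (nat (d - 1)) :: real)"
      using 3 by (simp del: nat_diff_distrib')
    then show ?thesis using 3 by (simp add: inv_fact_def)
  qed (auto simp: inv_fact_def)
qed

text \<open>This is \<open>n! (n+k)! / (k!^3 (n-k)!^2)\<close>; for \<open>k > n\<close> both sides
  are zero.\<close>

lemma apery_term_eq:
  "real ((n choose k)\<^sup>2 * (n + k choose k)) =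
    fact n * fact (n + k) * inv_fact (int k) ^ 3 * inv_fact (int n - int k) ^ 2"
proof (cases "k \<le> n")
  case True
  then have "inv_fact (int n - int k) = 1 / fact (n - k)"
    by (simp add: inv_fact_def of_nat_diff flip: of_nat_diff)
  then show ?thesis
    using True by (simp add: binomial_fact inv_fact_def power_divide field_simps eval_nat_numeral)
next
  case False
  then show ?thesis by (simp add: inv_fact_def)
qed

text \<open>The telescoping certificate \<open>B\<close> is the one of Apery's irrationality proof for \<open>\<zeta>(2)\<close>.\<close>
lemma apery_term_telescope:
  fixes n k :: nat
  defines "F \<equiv> \<lambda>n k. real ((n choose k)\<^sup>2 * (n + k choose k))"
  defines "B \<equiv> \<lambda>n k. (real k ^ 2 + 3 * (2 * real n + 1) * real k - 11 * real n ^ 2 - 9 * real n - 2) * F n k"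
  shows "real (n + 2) ^ 2 * F (n + 2) k - (11 * real (n + 1) ^ 2 + 11 * real (n + 1) + 3) * F (n + 1) k
           - real (n + 1) ^ 2 * F n k = B (n + 1) k - (if k = 0 then 0 else B (n + 1) (k - 1))"
proof -
  define a where "a = inv_fact (int k)"
  \<comment> \<open>The largest of the three arguments is taken, so the reciprocals for
    \<open>n\<close> and \<open>n + 1\<close> are polynomial multiples of \<open>b\<close> and all
    terms share the factor \<open>c\<close> below.\<close>
  define b where "b = inv_fact (int n + 2 - int k)"
  have b1: "inv_fact (int n + 1 - int k) = (real n + 2 - real k) * b"
    using inv_fact_diff_1[of "int n + 2 - int k"] by (simp add: b_def algebra_simps)
  have b0: "inv_fact (int n - int k) = (real n + 1 - real k) * (real n + 2 - real k) * b"
    using inv_fact_diff_1[of "int n + 1 - int k"] unfolding b1 by simp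
  define c where "c = fact n * fact (n + k) * a ^ 3 * b ^ 2"
  have F0: "F n k = c * ((real n + 1 - real k) * (real n + 2 - real k)) ^ 2"
    unfolding F_def apery_term_eq b0 a_def[symmetric] c_def by (simp add: power_mult_distrib)
  have b1': "inv_fact (int (n + 1) - int k) = (real n + 2 - real k) * b"
    using b1 by (simp add: add_ac)
  have F1: "F (n + 1) k = c * ((real n + 1) * (real n + real k + 1) * (real n + 2 - real k) ^ 2)"
    unfolding F_def apery_term_eq b1' a_def[symmetric] c_def by (simp add: power_mult_distrib add_ac)
  have b2': "inv_fact (int (n + 2) - int k) = b"
    by (simp add: b_def add_ac)
  have F2: "F (n + 2) k = c * ((real n + 2) * (real n + 1) * (real n + real k + 2) * (real n + real k + 1))"
    unfolding F_def apery_term_eq b2' a_def[symmetric] c_def by (simp add: add_ac)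
  show ?thesis
  proof (cases k)
    case 0
    have "real k = 0" by (simp add: 0)
    then have "real (n + 2) ^ 2 * F (n + 2) k - (11 * real (n + 1) ^ 2 + 11 * real (n + 1) + 3) * F (n + 1) k
           - real (n + 1) ^ 2 * F n k = B (n + 1) k"
      unfolding B_def F2 F1 F0 of_nat_add of_nat_1 of_nat_numeral by algebra
    then show ?thesis by (simp add: 0)
  next
    case (Suc j)
    have a1: "inv_fact (int j) = (real k) * a"
      using inv_fact_diff_1[of "int k"] by (simp add: a_def Suc)
    have b2: "inv_fact (int (n + 1) - int j) = b"
      by (simp add: b_def Suc algebra_simps)
    have F3: "F (n + 1) j = c * ((real n + 1) * real k ^ 3)"
      unfolding F_def apery_term_eq a1 b2 c_def by (simp add: Suc power_mult_distrib)
    have j: "real j = real k - 1" by (simp add: Suc)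
    have "real (n + 2) ^ 2 * F (n + 2) k - (11 * real (n + 1) ^ 2 + 11 * real (n + 1) + 3) * F (n + 1) k
           - real (n + 1) ^ 2 * F n k = B (n + 1) k - B (n + 1) j"
      unfolding B_def F2 F1 F0 F3 j of_nat_add of_nat_1 of_nat_numeral by algebra
    then show ?thesis by (simp add: Suc)
  qed
qed

text \<open>Terms with \<open>k > n\<close> vanish, so the three sums in the recurrence can share
  one range.\<close>

lemma apery_eq_sum:
  assumes "n \<le> m"
  shows "real (apery n) = (\<Sum>k\<le>m. real ((n choose k)\<^sup>2 * (n + k choose k)))"
  unfolding apery_def of_nat_sum
  by (rule sum.mono_neutral_left) (use assms in auto)

lemma sum_telescope_atMost_if:
  fixes g :: "nat \<Rightarrow> real"
  shows "(\<Sum>k\<le>m. g k - (if k = 0 then 0 else g (k - 1))) = g m"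
  by (induction m) auto

lemma apery_recurrence:
  "real (n + 2) ^ 2 * apery (n + 2) =
     (11 * real (n + 1) ^ 2 + 11 * real (n + 1) + 3) * apery (n + 1) + real (n + 1) ^ 2 * apery n"
proof -
  define F where "F = (\<lambda>n k. real ((n choose k)\<^sup>2 * (n + k choose k)))"
  define B where "B = (\<lambda>k. (real k ^ 2 + 3 * (2 * real (n + 1) + 1) * real k - 11 * real (n + 1) ^ 2
                          - 9 * real (n + 1) - 2) * F (n + 1) k)"
  have sums: "real (apery m) = (\<Sum>k\<le>n + 2. F m k)" if "m \<le> n + 2" for m
    unfolding F_def using that by (rule apery_eq_sum)
  have "real (n + 2) ^ 2 * apery (n + 2) - (11 * real (n + 1) ^ 2 + 11 * real (n + 1) + 3) * apery (n + 1)
           - real (n + 1) ^ 2 * apery n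
        = (\<Sum>k\<le>n + 2. real (n + 2) ^ 2 * F (n + 2) k
             - (11 * real (n + 1) ^ 2 + 11 * real (n + 1) + 3) * F (n + 1) k - real (n + 1) ^ 2 * F n k)"
    by (simp only: sums sum_subtractf sum_distrib_left le_add1 le_refl add_le_mono one_le_numeral)
  also have "\<dots> = (\<Sum>k\<le>n + 2. B k - (if k = 0 then 0 else B (k - 1)))"
    unfolding F_def B_def by (intro sum.cong refl apery_term_telescope)
  also have "\<dots> = B (n + 2)"
    by (rule sum_telescope_atMost_if)
  \<comment> \<open>The boundary term contains \<open>(n + 1) choose (n + 2)\<close>, which is
    zero.\<close>
  also have "\<dots> = 0"
    by (simp add: B_def F_def binomial_eq_0 del: binomial_Suc_Suc)
  finally show ?thesis by simp
qed

lemma apery_le: "apery n \<le> 16 ^ n"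
proof -
  have "apery n \<le> (\<Sum>k\<le>n. (n choose k) * 2 ^ n * 2 ^ (2 * n))"
    unfolding apery_def power2_eq_square
  proof (intro sum_mono mult_mono le_refl)
    fix k assume "k \<in> {..n}"
    then show "n + k choose k \<le> 2 ^ (2 * n)"
      by (intro order.trans[OF binomial_le_pow2] power_increasing) auto
  qed (auto simp: binomial_le_pow2)
  also have "\<dots> = 2 ^ n * 2 ^ n * 2 ^ (2 * n)"
    by (simp add: choose_row_sum flip: sum_distrib_right)
  also have "\<dots> = 16 ^ n"
    by (simp add: power_mult flip: power_mult_distrib)
  finally show ?thesis .
qed

section \<open>Generating series and the functions they define\<close>

definition apery_fps :: "complex fps" where
  "apery_fps = Abs_fps (\<lambda>n. of_nat (apery n))"

text \<open>Division by zero yields zero, so the coefficient at \<open>n = 0\<close> is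
  \<open>0\<close>.\<close>

definition apery_log_fps :: "complex fps" where
  "apery_log_fps = Abs_fps (\<lambda>n. of_nat (apery n) / of_nat n)"

text \<open>Naming this series turns the second-order equation into a first-order system.\<close>

definition apery_flux_fps :: "complex fps" where
  "apery_flux_fps = (1 - 11 * fps_X - fps_X ^ 2) * fps_X * fps_deriv apery_fps"

lemma apery_0 [simp]: "apery 0 = 1" and apery_1 [simp]: "apery (Suc 0) = 3"
  by (auto simp: apery_def numeral_2_eq_2)

text \<open>In degree \<open>0\<close> this is \<open>a_1 = 3\<close>; in degree
  \<open>m + 1\<close> it is \<open>apery_recurrence\<close> at \<open>m\<close>, since
  \<open>(m + 1)^2 = m (m + 2) + 1\<close>.\<close>

lemma deriv_apery_flux_fps: "fps_deriv apery_flux_fps = (3 + fps_X) * apery_fps"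
proof (rule fps_ext)
  fix n
  have nth: "fps_nth apery_flux_fps (Suc m) = of_nat (Suc m) * of_nat (apery (Suc m))
      - (11 * of_nat m * of_nat (apery m)) - (if m = 0 then 0 else of_nat (m - 1) * of_nat (apery (m - 1)))" for m
  proof -
    have *: "apery_flux_fps = fps_X * fps_deriv apery_fps - 11 * (fps_X * (fps_X * fps_deriv apery_fps))
            - fps_X * (fps_X * (fps_X * fps_deriv apery_fps))"
      unfolding apery_flux_fps_def by (simp add: algebra_simps power2_eq_square)
    show ?thesis
      unfolding * by (cases m) (auto simp: apery_fps_def fps_numeral_fps_const)
  qed
  show "fps_nth (fps_deriv apery_flux_fps) n = fps_nth ((3 + fps_X) * apery_fps) n"
  proof (cases n)
    case 0
    then show ?thesis
      by (simp add: nth apery_fps_def)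
  next
    case (Suc m)
    have "of_nat (m + 2) ^ 2 * of_nat (apery (m + 2)) = (11 * of_nat (m + 1) ^ 2 + 11 * of_nat (m + 1) + 3)
            * of_nat (apery (m + 1)) + of_nat (m + 1) ^ 2 * (of_nat (apery m) :: complex)"
      using arg_cong[OF apery_recurrence[of m], of complex_of_real] by simp
    then show ?thesis
      unfolding Suc by (simp add: nth ring_distribs) (simp add: apery_fps_def fps_numeral_fps_const algebra_simps power2_eq_square)
  qed
qed

lemma fps_conv_radius_geI:
  fixes f :: "complex fps"
  assumes "\<And>n. norm (fps_nth f n) \<le> C ^ n" "C > 0"
  shows "fps_conv_radius f \<ge> ereal (1 / C)"
  unfolding fps_conv_radius_def
proof (rule conv_radius_geI_ex')
  fix r assume r: "0 < r" "ereal r < ereal (1 / C)"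
  then have "summable (\<lambda>n. (C * r) ^ n)"
    using assms(2) by (intro summable_geometric) (simp add: field_simps)
  then show "summable (\<lambda>n. fps_nth f n * complex_of_real r ^ n)"
    by (rule summable_comparison_test')
       (use assms r in \<open>auto simp: norm_mult norm_power power_mult_distrib intro!: mult_right_mono\<close>)
qed

lemma fps_conv_radius_apery: "fps_conv_radius apery_fps \<ge> ereal (1 / 16)"
proof (rule fps_conv_radius_geI)
  show "norm (fps_nth apery_fps n) \<le> 16 ^ n" for n
    using of_nat_mono[OF apery_le[of n], where 'a = real] by (simp add: apery_fps_def)
qed simp

lemma fps_conv_radius_apery_log: "fps_conv_radius apery_log_fps \<ge> ereal (1 / 16)"
proof (rule fps_conv_radius_geI)
  show "norm (fps_nth apery_log_fps n) \<le> 16 ^ n" for n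
  proof -
    have "real (apery n) / real n \<le> real (apery n)"
      by (cases n) (auto simp: divide_le_eq mult_le_cancel_left1)
    also have "\<dots> \<le> 16 ^ n"
      using of_nat_mono[OF apery_le[of n], where 'a = real] by simp
    finally show ?thesis by (simp add: apery_log_fps_def norm_divide)
  qed
qed simp

definition apery_fun :: "complex \<Rightarrow> complex" where
  "apery_fun = eval_fps apery_fps"

definition apery_fun' :: "complex \<Rightarrow> complex" where
  "apery_fun' = eval_fps (fps_deriv apery_fps)"

definition apery_flux :: "complex \<Rightarrow> complex" where
  "apery_flux t = (1 - 11 * t - t ^ 2) * t * apery_fun' t"

definition apery_log :: "complex \<Rightarrow> complex" where
  "apery_log = eval_fps apery_log_fps"

definition apery_log' :: "complex \<Rightarrow> complex" where
  "apery_log' = eval_fps (fps_deriv apery_log_fps)"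

text \<open>Carries the identities of formal series over to functions on the disc of radius
  \<open>1 / 16\<close>, where all the series converge.\<close>

lemma
  assumes "norm t < 1 / 16"
  shows has_field_derivative_apery_fun: "(apery_fun has_field_derivative apery_fun' t) (at t within A)"
    and has_field_derivative_apery_flux: "(apery_flux has_field_derivative (3 + t) * apery_fun t) (at t within A)"
    and has_field_derivative_apery_log: "(apery_log has_field_derivative apery_log' t) (at t within A)"
    and apery_log'_eq: "t * apery_log' t = apery_fun t - 1"
proof -
  have t: "ereal (norm s) < fps_conv_radius apery_fps" "ereal (norm s) < fps_conv_radius apery_log_fps"
          "ereal (norm s) < fps_conv_radius (fps_deriv apery_fps)"
          "ereal (norm s) < fps_conv_radius (fps_deriv apery_log_fps)"
        if "norm s < 1 / 16" for s :: complex
  proof -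
    have "ereal (norm s) < ereal (1 / 16)" using that by simp
    then show "ereal (norm s) < fps_conv_radius apery_fps" "ereal (norm s) < fps_conv_radius apery_log_fps"
      "ereal (norm s) < fps_conv_radius (fps_deriv apery_fps)"
      "ereal (norm s) < fps_conv_radius (fps_deriv apery_log_fps)"
      using fps_conv_radius_apery fps_conv_radius_apery_log fps_conv_radius_deriv[of apery_fps]
        fps_conv_radius_deriv[of apery_log_fps] by (meson less_le_trans)+
  qed
  show "(apery_fun has_field_derivative apery_fun' t) (at t within A)"
    unfolding apery_fun_def apery_fun'_def using t assms by (intro has_field_derivative_eval_fps)
  show "(apery_log has_field_derivative apery_log' t) (at t within A)"
    unfolding apery_log_def apery_log'_def using t assms by (intro has_field_derivative_eval_fps)
  have "fps_X * fps_deriv apery_log_fps = apery_fps - 1"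
    by (rule fps_ext) (auto simp: apery_fps_def apery_log_fps_def simp del: of_nat_Suc)
  then have "eval_fps (fps_X * fps_deriv apery_log_fps) t = eval_fps (apery_fps - 1) t"
    by simp
  then show "t * apery_log' t = apery_fun t - 1"
    using t[OF assms] by (simp add: eval_fps_mult eval_fps_diff apery_fun_def apery_log'_def)
  define p :: "complex fps" where "p = (1 - 11 * fps_X - fps_X ^ 2) * fps_X"
  \<comment> \<open>As a polynomial, \<open>p\<close> does not shrink the radius of convergence of
    the product.\<close>
  have p: "p = fps_of_poly ([:1, -11, -1:] * [:0, 1:])"
    unfolding p_def by (simp add: fps_of_poly_mult fps_of_poly_pCons algebra_simps power2_eq_square
       fps_numeral_fps_const flip: fps_const_neg)
  have flux: "apery_flux s = eval_fps apery_flux_fps s" if "norm s < 1 / 16" for s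
    unfolding apery_flux_def apery_flux_fps_def p_def[symmetric]
    unfolding p apery_fun'_def using t[OF that]
    by (simp add: eval_fps_mult algebra_simps power2_eq_square)
  have "(eval_fps apery_flux_fps has_field_derivative eval_fps (fps_deriv apery_flux_fps) t) (at t)"
  proof (rule has_field_derivative_eval_fps)
    show "ereal (norm t) < fps_conv_radius apery_flux_fps"
      unfolding apery_flux_fps_def p_def[symmetric] unfolding p
      using t[OF assms] by (intro less_le_trans[OF _ fps_conv_radius_mult]) simp
  qed
  moreover have "eval_fps (fps_deriv apery_flux_fps) t = (3 + t) * apery_fun t"
    unfolding deriv_apery_flux_fps apery_fun_def using t[OF assms]
    by (subst eval_fps_mult) (auto simp: eval_fps_add intro!: less_le_trans[OF _ fps_conv_radius_add])
  ultimately have "(eval_fps apery_flux_fps has_field_derivative (3 + t) * apery_fun t) (at t)"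
    by simp
  then have "(apery_flux has_field_derivative (3 + t) * apery_fun t) (at t)"
    by (rule has_field_derivative_transform_within_open[of _ _ _ "ball 0 (1 / 16)"])
       (use assms flux in auto)
  then show "(apery_flux has_field_derivative (3 + t) * apery_fun t) (at t within A)"
    by (rule has_field_derivative_at_within)
qed

section \<open>The Mahler measure as a power series\<close>

lemma has_integral_cis_int:
  "((\<lambda>\<theta>. cis (2 * pi * \<theta> * of_int m)) has_integral (if m = 0 then 1 else 0)) {0..1}"
proof (cases "m = 0")
  case True
  then show ?thesis using has_integral_const_real[of "1 :: complex" 0 1] by simp
next
  case False
  define F where "F \<theta> = cis (2 * pi * \<theta> * of_int m) / (2 * pi * \<i> * of_int m)" for \<theta>
  have "((\<lambda>\<theta>. cis (2 * pi * \<theta> * of_int m)) has_integral F 1 - F 0) {0..1}"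
  proof (rule fundamental_theorem_of_calculus)
    fix x :: real
    show "(F has_vector_derivative cis (2 * pi * x * of_int m)) (at x within {0..1})"
    proof -
      have "((\<lambda>z. exp (2 * pi * \<i> * of_int m * z) / (2 * pi * \<i> * of_int m)) has_field_derivative
              exp (2 * pi * \<i> * of_int m * of_real x)) (at (of_real x))"
        using False by (auto intro!: derivative_eq_intros)
      from has_vector_derivative_real_field[OF this] show ?thesis
        unfolding F_def [abs_def] cis_conv_exp by (simp add: mult_ac)
    qed
  qed simp
  moreover have "F 1 = F 0"
    by (simp add: F_def)
  ultimately show ?thesis using False by simp
qed

text \<open>The integral extracts the constant term of the Laurent polynomial
  \<open>(x + 1)^N / x^k\<close>.\<close>

lemma has_integral_binomial_cis:
  "((\<lambda>\<theta>. (cis (2 * pi * \<theta>) + 1) ^ N / cis (2 * pi * \<theta>) ^ k) has_integral of_nat (N choose k)) {0..1}"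
proof -
  have "((\<lambda>\<theta>. \<Sum>i\<le>N. of_nat (N choose i) * cis (2 * pi * \<theta> * of_int (int i - int k))) has_integral
          (\<Sum>i\<le>N. of_nat (N choose i) * (if int i - int k = 0 then 1 else 0))) {0..1}"
    by (intro has_integral_sum has_integral_mult_right has_integral_cis_int) auto
  also have "(\<Sum>i\<le>N. of_nat (N choose i) * (if int i - int k = 0 then 1 else 0 :: complex)) = of_nat (N choose k)"
    by (simp add: if_distrib[of "\<lambda>x. _ * x"] sum.delta cong: if_cong)
  also have "(\<lambda>\<theta>. \<Sum>i\<le>N. of_nat (N choose i) * cis (2 * pi * \<theta> * of_int (int i - int k)))
           = (\<lambda>\<theta>. (cis (2 * pi * \<theta>) + 1) ^ N / cis (2 * pi * \<theta>) ^ k)"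
  proof
    fix \<theta> :: real
    have "cis (2 * pi * \<theta> * of_int (int i - int k)) = cis (2 * pi * \<theta>) ^ i / cis (2 * pi * \<theta>) ^ k" for i
      by (simp add: Complex.DeMoivre cis_divide algebra_simps)
    then show "(\<Sum>i\<le>N. of_nat (N choose i) * cis (2 * pi * \<theta> * of_int (int i - int k)))
           = (cis (2 * pi * \<theta>) + 1) ^ N / cis (2 * pi * \<theta>) ^ k"
      by (simp add: binomial_ring sum_divide_distrib)
  qed
  finally show ?thesis .
qed

section \<open>Integration over the unit square and the Laurent polynomial on the torus\<close>

abbreviation unit_square :: "(real \<times> real) set" where
  "unit_square \<equiv> {0..1} \<times> {0..1}"

lemma set_integrable_unit_square:
  fixes f :: "real \<times> real \<Rightarrow> complex"
  assumes "continuous_on unit_square f"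
  shows "set_integrable lborel unit_square f"
  unfolding set_integrable_def using assms by (intro borel_integrable_compact compact_Times) auto

text \<open>Fubini; continuity on the compact square supplies integrability.\<close>

lemma set_lebesgue_integral_unit_square_product:
  fixes g h :: "real \<Rightarrow> complex"
  assumes "continuous_on {0..1} g" "continuous_on {0..1} h"
  assumes "(g has_integral a) {0..1}" "(h has_integral b) {0..1}"
  shows "(LINT (x, y):unit_square|lborel. g x * h y) = a * b"
proof -
  have ints: "set_lebesgue_integral lborel {0..1} f = c"
    if "continuous_on {0..1} f" "(f has_integral c) {0..1}" for f :: "real \<Rightarrow> complex" and c
    using set_borel_integral_eq_integral(2)[of "{0..1}" f] that borel_integrable_compact[of "{0..1}" f]
    by (auto simp: set_integrable_def integral_unique)
  have "continuous_on unit_square (\<lambda>(x, y). g x * h y)"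
    unfolding case_prod_unfold
    by (intro continuous_intros continuous_on_compose2[OF assms(1)] continuous_on_compose2[OF assms(2)]) auto
  then have "integrable (lborel \<Otimes>\<^sub>M lborel) (\<lambda>p. indicator unit_square p *\<^sub>R (case p of (x, y) \<Rightarrow> g x * h y))"
    using set_integrable_unit_square by (simp add: set_integrable_def lborel_prod)
  from lborel_pair.integral_fst'[OF this]
  have "(LINT (x, y):unit_square|lborel. g x * h y)
      = (\<integral>x. (\<integral>y. (indicator {0..1} x *\<^sub>R g x) * (indicator {0..1} y *\<^sub>R h y) \<partial>lborel) \<partial>lborel)"
    by (simp add: set_lebesgue_integral_def lborel_prod indicator_times mult_ac)
  also have "\<dots> = a * b"
    using ints[OF assms(1,3)] ints[OF assms(2,4)]
    by (simp add: set_lebesgue_integral_def del: mult_scaleR_left mult_scaleR_right)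
  finally show ?thesis .
qed

text \<open>On the torus the polynomial in \<open>rfam\<close> is
  \<open>-(x y / t) (1 - t Q)\<close> with this \<open>Q\<close>, so its modulus is
  \<open>|1 - t Q| / |t|\<close>.\<close>

definition Qtor :: "real \<times> real \<Rightarrow> complex" where
  "Qtor = (\<lambda>(\<theta>, \<phi>). (cis (2 * pi * \<theta>) + cis (2 * pi * \<phi>) + 1) * (cis (2 * pi * \<theta>) + 1) * (cis (2 * pi * \<phi>) + 1)
              / (cis (2 * pi * \<theta>) * cis (2 * pi * \<phi>)))"

lemma continuous_on_Qtor: "continuous_on A Qtor"
  unfolding Qtor_def case_prod_unfold by (intro continuous_intros) auto

text \<open>Since \<open>12 / 16 = 3 / 4 < 1\<close>, the logarithm series of \<open>1 - t Q\<close>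
  converges uniformly on the torus for \<open>|t| < 1 / 16\<close>.\<close>

lemma norm_Qtor_le: "norm (Qtor p) \<le> 12"
proof -
  obtain \<theta> \<phi> where p: "p = (\<theta>, \<phi>)" by force
  define x y where "x = cis (2 * pi * \<theta>)" and "y = cis (2 * pi * \<phi>)"
  have [simp]: "norm x = 1" "norm y = 1" by (auto simp: x_def y_def)
  have "norm (x + y + 1) \<le> 3" "norm (x + 1) \<le> 2" "norm (y + 1) \<le> 2"
    using norm_triangle_ineq[of "x + y" 1] norm_triangle_ineq[of x y] norm_triangle_ineq[of x 1]
      norm_triangle_ineq[of y 1] by auto
  then have "norm (x + y + 1) * norm (x + 1) * norm (y + 1) \<le> 3 * 2 * 2"
    by (intro mult_mono) auto
  then show ?thesis
    by (simp add: p Qtor_def norm_mult norm_divide flip: x_def y_def)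
qed

text \<open>Grouping \<open>x + y + 1\<close> as \<open>(x + 1) + y\<close> splits each summand into
  a function of \<open>x\<close> times a function of \<open>y\<close>.\<close>

lemma Qtor_power:
  "Qtor (\<theta>, \<phi>) ^ n = (\<Sum>k\<le>n. of_nat (n choose k) *
     ((cis (2 * pi * \<theta>) + 1) ^ (n + k) / cis (2 * pi * \<theta>) ^ n * ((cis (2 * pi * \<phi>) + 1) ^ n / cis (2 * pi * \<phi>) ^ k)))"
proof -
  define x y where "x = cis (2 * pi * \<theta>)" and "y = cis (2 * pi * \<phi>)"
  have nz: "x \<noteq> 0" "y \<noteq> 0" by (auto simp: x_def y_def)
  have "Qtor (\<theta>, \<phi>) ^ n = ((x + 1) + y) ^ n * ((x + 1) ^ n * (y + 1) ^ n / (x ^ n * y ^ n))"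
    unfolding Qtor_def x_def[symmetric] y_def[symmetric] prod.case
    by (simp add: power_divide power_mult_distrib add_ac)
  also have "\<dots> = (\<Sum>k\<le>n. of_nat (n choose k) * ((x + 1) ^ (n + k) / x ^ n * ((y + 1) ^ n / y ^ k)))"
    unfolding binomial_ring[of "x + 1" y n] sum_distrib_right
  proof (intro sum.cong refl)
    fix k assume "k \<in> {..n}"
    then have "y ^ n = y ^ (n - k) * y ^ k" by (simp flip: power_add)
    then show "of_nat (n choose k) * (x + 1) ^ k * y ^ (n - k) * ((x + 1) ^ n * (y + 1) ^ n / (x ^ n * y ^ n))
       = of_nat (n choose k) * ((x + 1) ^ (n + k) / x ^ n * ((y + 1) ^ n / y ^ k))"
      using nz by (simp add: power_add)
  qed
  finally show ?thesis unfolding x_def y_def .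
qed

text \<open>Besides its weight \<open>n choose k\<close>, the summand for \<open>k\<close>
  contributes \<open>(n + k) choose n\<close> from \<open>x\<close> and \<open>n choose k\<close>
  from \<open>y\<close>.\<close>

lemma integral_Qtor_power: "(LINT p:unit_square|lborel. Qtor p ^ n) = of_nat (apery n)"
proof -
  define g where "g k \<theta> = (cis (2 * pi * \<theta>) + 1) ^ (n + k) / cis (2 * pi * \<theta>) ^ n" for k \<theta>
  define h where "h k \<phi> = (cis (2 * pi * \<phi>) + 1) ^ n / cis (2 * pi * \<phi>) ^ k" for k \<phi>
  have cont: "continuous_on A (g k)" "continuous_on A (h k)" for A k
    unfolding g_def [abs_def] h_def [abs_def] by (intro continuous_intros; simp)+
  have cont': "continuous_on unit_square (\<lambda>(\<theta>, \<phi>). g k \<theta> * h k \<phi>)" for k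
    unfolding case_prod_unfold
    by (intro continuous_intros continuous_on_compose2[OF cont(1)] continuous_on_compose2[OF cont(2)]) auto
  have "(LINT p:unit_square|lborel. Qtor p ^ n)
      = (LINT p:unit_square|lborel. (\<Sum>k\<le>n. of_nat (n choose k) * (case p of (\<theta>, \<phi>) \<Rightarrow> g k \<theta> * h k \<phi>)))"
    unfolding g_def h_def by (rule arg_cong[where f = "set_lebesgue_integral lborel unit_square"], intro ext) (auto simp: Qtor_power)
  also have "\<dots> = (\<Sum>k\<le>n. of_nat (n choose k) * (LINT p:unit_square|lborel. (case p of (\<theta>, \<phi>) \<Rightarrow> g k \<theta> * h k \<phi>)))"
  proof -
    have "set_integrable lborel unit_square (\<lambda>p. of_nat (n choose k) * (case p of (\<theta>, \<phi>) \<Rightarrow> g k \<theta> * h k \<phi>))" for k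
      by (intro set_integrable_mult_right set_integrable_unit_square cont')
    then have "(LINT p:unit_square|lborel. (\<Sum>k\<le>n. of_nat (n choose k) * (case p of (\<theta>, \<phi>) \<Rightarrow> g k \<theta> * h k \<phi>)))
      = (\<Sum>k\<le>n. (LINT p:unit_square|lborel. of_nat (n choose k) * (case p of (\<theta>, \<phi>) \<Rightarrow> g k \<theta> * h k \<phi>)))"
      unfolding set_lebesgue_integral_def set_integrable_def scaleR_sum_right
      by (intro Bochner_Integration.integral_sum)
    then show ?thesis by simp
  qed
  also have "\<dots> = (\<Sum>k\<le>n. of_nat (n choose k) * (of_nat (n + k choose n) * of_nat (n choose k)))"
    unfolding g_def h_def
    by (intro sum.cong refl arg_cong2[of _ _ _ _ "(*)"] set_lebesgue_integral_unit_square_product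
          has_integral_binomial_cis continuous_intros) auto
  also have "\<dots> = of_nat (apery n)"
    unfolding apery_def of_nat_sum
    by (intro sum.cong refl) (simp add: power2_eq_square binomial_symmetric[of n])
  finally show ?thesis .
qed

text \<open>The geometric series of ratio \<open>3 / 4\<close> dominates the logarithm series and
  permits termwise integration.\<close>

lemma integral_Ln_Qtor:
  assumes "norm t < 1 / 16"
  shows "(LINT p:unit_square|lborel. Ln (1 - t * Qtor p)) = - apery_log t"
    and "set_integrable lborel unit_square (\<lambda>p. Ln (1 - t * Qtor p))"
proof -
  \<comment> \<open>The term \<open>n = 0\<close> is zero by division by zero, as in
    \<open>apery_log_fps\<close>.\<close>
  define f where "f n p = indicator unit_square p *\<^sub>R (- ((t * Qtor p) ^ n / of_nat n))" for n p
  have small: "norm (t * Qtor p) \<le> 3 / 4" for p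
    using mult_mono[OF less_imp_le[OF assms] norm_Qtor_le[of p]] by (simp add: norm_mult)
  have int: "set_integrable lborel unit_square (\<lambda>p. - ((t * Qtor p) ^ n / of_nat n))" for n
    unfolding divide_inverse by (intro set_integrable_unit_square continuous_intros continuous_on_Qtor)
  have f_int: "integral\<^sup>L lborel (f n) = - (of_nat (apery n) / of_nat n * t ^ n)" for n
  proof -
    have "integral\<^sup>L lborel (f n) = (LINT p:unit_square|lborel. (- (t ^ n) / of_nat n) * Qtor p ^ n)"
      unfolding f_def set_lebesgue_integral_def by (simp add: power_mult_distrib)
    then show ?thesis
      unfolding set_integral_mult_right integral_Qtor_power by simp
  qed
  have sums: "(\<lambda>n. f n p) sums (indicator unit_square p *\<^sub>R Ln (1 - t * Qtor p))" for p
  proof -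
    have "(\<lambda>n. (-1) ^ Suc n / of_nat n * (- (t * Qtor p)) ^ n) sums ln (1 + (- (t * Qtor p)))"
      using small[of p] by (intro Ln_series) auto
    moreover have "(-1) ^ Suc n / of_nat n * (- (t * Qtor p)) ^ n = - ((t * Qtor p) ^ n / of_nat n)" for n
      by (simp add: power_minus[of "t * Qtor p"] flip: power_add mult_2)
    ultimately show ?thesis
      unfolding f_def by (intro sums_scaleR_right) (simp only: add_uminus_conv_diff)
  qed
  have bound: "norm (f n p) \<le> indicator unit_square p * (3 / 4) ^ n" for n p
  proof -
    have "norm ((t * Qtor p) ^ n / of_nat n) \<le> norm ((t * Qtor p) ^ n)"
      by (cases n) (auto simp: norm_divide divide_le_eq mult_le_cancel_left1 simp del: of_nat_Suc)
    also have "\<dots> \<le> (3 / 4) ^ n"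
      unfolding norm_power by (intro power_mono small) auto
    finally show ?thesis by (auto simp: f_def indicator_def)
  qed
  have geo: "summable (\<lambda>n. (3 / 4 :: real) ^ n)" by (rule summable_geometric) simp
  have ind: "integrable lborel (indicator unit_square :: _ \<Rightarrow> real)"
    using borel_integrable_compact[of unit_square "\<lambda>_. 1 :: real"] by (simp add: compact_Times)
  define c where "c = integral\<^sup>L lborel (indicator unit_square :: _ \<Rightarrow> real)"
  have summable_norm: "AE p in lborel. summable (\<lambda>n. norm (f n p))"
  proof (intro AE_I2 summable_comparison_test'[OF geo])
    show "norm (norm (f n p)) \<le> (3 / 4) ^ n" if "n \<ge> 0" for n p
      using bound[of n p] by (cases "p \<in> unit_square") (auto simp del: mem_Times_iff intro: order.trans)
  qed
  have f_integrable: "integrable lborel (f n)" for n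
    using int[of n] unfolding set_integrable_def f_def .
  have summable_int: "summable (\<lambda>n. \<integral>p. norm (f n p) \<partial>lborel)"
  proof (rule summable_comparison_test'[OF summable_mult[OF geo, of c]])
    fix n :: nat
    have "(\<integral>p. norm (f n p) \<partial>lborel) \<le> (\<integral>p. indicator unit_square p * (3 / 4) ^ n \<partial>lborel)"
      by (intro integral_mono integrable_norm f_integrable integrable_mult_left ind bound)
    also have "\<dots> = c * (3 / 4) ^ n" by (simp add: c_def)
    finally show "norm (\<integral>p. norm (f n p) \<partial>lborel) \<le> c * (3 / 4) ^ n" by simp
  qed
  note thms = f_integrable summable_norm summable_int
  have suminf: "(\<Sum>n. f n p) = indicator unit_square p *\<^sub>R Ln (1 - t * Qtor p)" for p
    using sums[of p] by (rule sums_unique[symmetric])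
  show "set_integrable lborel unit_square (\<lambda>p. Ln (1 - t * Qtor p))"
    using integrable_suminf[OF thms] unfolding set_integrable_def suminf .
  have "(LINT p:unit_square|lborel. Ln (1 - t * Qtor p)) = (\<Sum>n. - (of_nat (apery n) / of_nat n * t ^ n))"
    using integral_suminf[OF thms] unfolding set_lebesgue_integral_def suminf f_int .
  also have "\<dots> = - apery_log t"
  proof -
    have "ereal (norm t) < fps_conv_radius apery_log_fps"
      using assms by (intro less_le_trans[OF _ fps_conv_radius_apery_log]) simp
    from sums_eval_fps[OF this] show ?thesis
      by (intro sums_unique[symmetric] sums_minus) (simp add: apery_log_def apery_log_fps_def)
  qed
  finally show "(LINT p:unit_square|lborel. Ln (1 - t * Qtor p)) = - apery_log t" .
qed

lemma rfam_eq:
  assumes "t \<noteq> 0" "norm t < 1 / 16"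
  shows "rfam t = - ln (norm t) - Re (apery_log t)"
proof -
  \<comment> \<open>The power \<open>0\<close> stands for the constant \<open>1\<close>, whose
    integral is then \<open>integral_Qtor_power\<close> at \<open>0\<close>.\<close>
  have pw: "ln (cmod ((x + y + 1) * (x + 1) * (y + 1) - 1 / t * x * y)) = Re (Ln (1 - t * Qtor (\<theta>, \<phi>)) - of_real (ln (norm t)) * Qtor (\<theta>, \<phi>) ^ 0)"
    if "x = cis (2 * pi * \<theta>)" "y = cis (2 * pi * \<phi>)" for x y \<theta> \<phi>
  proof -
    have nz: "x \<noteq> 0" "y \<noteq> 0" "norm x = 1" "norm y = 1" using that by auto
    have "norm (t * Qtor (\<theta>, \<phi>)) < 1"
      using mult_mono[OF less_imp_le[OF assms(2)] norm_Qtor_le[of "(\<theta>, \<phi>)"]] by (simp add: norm_mult)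
    then have nz': "1 - t * Qtor (\<theta>, \<phi>) \<noteq> 0" by auto
    have "(x + y + 1) * (x + 1) * (y + 1) - 1 / t * x * y = - (x * y / t) * (1 - t * Qtor (\<theta>, \<phi>))"
      using nz assms unfolding Qtor_def prod.case that(1)[symmetric] that(2)[symmetric] by (simp add: field_simps)
    then have "cmod ((x + y + 1) * (x + 1) * (y + 1) - 1 / t * x * y) = norm (1 - t * Qtor (\<theta>, \<phi>)) / norm t"
      using nz by (simp add: norm_mult norm_divide)
    then show ?thesis
      using nz' assms by (simp add: ln_div)
  qed
  have int1: "set_integrable lborel unit_square (\<lambda>p. of_real (ln (norm t)) * Qtor p ^ 0)"
    by (intro set_integrable_unit_square continuous_intros continuous_on_Qtor)
  have "rfam t = (LINT p:unit_square|lborel. Re (Ln (1 - t * Qtor p) - of_real (ln (norm t)) * Qtor p ^ 0))"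
    unfolding rfam_def mahler2_def case_prod_unfold pw[OF refl refl] prod.collapse ..
  also have "\<dots> = Re (LINT p:unit_square|lborel. Ln (1 - t * Qtor p) - of_real (ln (norm t)) * Qtor p ^ 0)"
    using set_integral_diff(1)[OF integral_Ln_Qtor(2)[OF assms(2)] int1]
    unfolding set_lebesgue_integral_def set_integrable_def by (subst integral_Re[symmetric]) auto
  also have "\<dots> = Re (- apery_log t - of_real (ln (norm t)))"
    using set_integral_diff(2)[OF integral_Ln_Qtor(2)[OF assms(2)] int1] integral_Ln_Qtor(1)[OF assms(2)]
      integral_Qtor_power[of 0] by (simp del: power_0)
  finally show ?thesis by simp
qed

section \<open>The modular equation of degree five\<close>

definition Ynum :: "complex \<Rightarrow> complex" where
  "Ynum u = 1 - 2 * u + 4 * u ^ 2 - 3 * u ^ 3 + u ^ 4"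

definition Yden :: "complex \<Rightarrow> complex" where
  "Yden u = 1 + 3 * u + 4 * u ^ 2 + 2 * u ^ 3 + u ^ 4"

definition Yden' :: "complex \<Rightarrow> complex" where
  "Yden' u = 3 + 8 * u + 6 * u ^ 2 + 4 * u ^ 3"

definition Yquad :: "complex \<Rightarrow> complex" where
  "Yquad u = 1 - u - u ^ 2"

section \<open>Polynomial identities satisfied by \<open>Y\<close>\<close>

lemma Yfun_eq: "Yfun u = u * Ynum u / Yden u"
  by (simp add: Yfun_def Ynum_def Yden_def)

text \<open>Shows that the singular polynomial at \<open>u^5\<close> is nonzero wherever the three
  factors are.\<close>

lemma Yquad_Ynum_Yden: "Yquad u * Ynum u * Yden u = 1 - 11 * u ^ 5 - (u ^ 5) ^ 2"
  unfolding Yquad_def Ynum_def Yden_def by algebra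

lemma Yfun_discriminant:
  assumes "Yden u \<noteq> 0"
  shows "1 - 11 * Yfun u - Yfun u ^ 2 = Yquad u ^ 5 / Yden u ^ 2"
proof -
  have "Yden u ^ 2 - 11 * u * Ynum u * Yden u - u ^ 2 * Ynum u ^ 2 = Yquad u ^ 5"
    unfolding Yquad_def Ynum_def Yden_def by algebra
  moreover have "1 - 11 * Yfun u - Yfun u ^ 2
      = (Yden u ^ 2 - 11 * u * Ynum u * Yden u - u ^ 2 * Ynum u ^ 2) / Yden u ^ 2"
    using assms by (simp add: Yfun_eq field_simps power2_eq_square)
  ultimately show ?thesis by simp
qed

lemma has_field_derivative_Yden: "(Yden has_field_derivative Yden' u) (at u)"
  unfolding Yden_def Yden'_def by (auto intro!: derivative_eq_intros simp: algebra_simps)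

lemma has_field_derivative_Ynum_over_Yden:
  assumes "Yden u \<noteq> 0"
  shows "((\<lambda>u. Ynum u / Yden u) has_field_derivative
           ((-2 + 8 * u - 9 * u ^ 2 + 4 * u ^ 3) * Yden u - Ynum u * Yden' u) / Yden u ^ 2) (at u)"
proof -
  have "(Ynum has_field_derivative (-2 + 8 * u - 9 * u ^ 2 + 4 * u ^ 3)) (at u)"
    unfolding Ynum_def by (auto intro!: derivative_eq_intros simp: algebra_simps)
  from DERIV_divide[OF this has_field_derivative_Yden assms] show ?thesis
    by (simp add: power2_eq_square)
qed

text \<open>With \<open>Yfun_discriminant\<close> this gives
  \<open>Y' / (Y (1 - 11 Y - Y^2)) = D^2 / (u (1 - 11 u^5 - u^10))\<close>, which explains the
  factor \<open>1 / D\<close> in the pullback.\<close>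

lemma has_field_derivative_Yfun:
  assumes "Yden u \<noteq> 0"
  shows "(Yfun has_field_derivative Yquad u ^ 4 / Yden u ^ 2) (at u)"
proof -
  have "((\<lambda>u. u * (Ynum u / Yden u)) has_field_derivative
      1 * (Ynum u / Yden u) + ((-2 + 8 * u - 9 * u ^ 2 + 4 * u ^ 3) * Yden u - Ynum u * Yden' u) / Yden u ^ 2 * u) (at u)"
    by (intro DERIV_mult DERIV_ident has_field_derivative_Ynum_over_Yden assms)
  also have "1 * (Ynum u / Yden u) + ((-2 + 8 * u - 9 * u ^ 2 + 4 * u ^ 3) * Yden u - Ynum u * Yden' u) / Yden u ^ 2 * u
      = (Ynum u * Yden u + ((-2 + 8 * u - 9 * u ^ 2 + 4 * u ^ 3) * Yden u - Ynum u * Yden' u) * u) / Yden u ^ 2"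
    using assms by (simp add: add_divide_distrib power2_eq_square)
  also have "Ynum u * Yden u + ((-2 + 8 * u - 9 * u ^ 2 + 4 * u ^ 3) * Yden u - Ynum u * Yden' u) * u = Yquad u ^ 4"
    unfolding Yquad_def Ynum_def Yden_def Yden'_def by algebra
  finally show ?thesis by (simp add: Yfun_eq [abs_def])
qed

text \<open>Collects the open conditions used below: both arguments lie in the disc of convergence,
  the denominators are nonzero, and the positive real part keeps \<open>Ynum u / Yden u\<close> off
  the branch cut of \<open>Ln\<close>.\<close>

definition Yregular :: "complex \<Rightarrow> bool" where
  "Yregular u \<longleftrightarrow> Ynum u \<noteq> 0 \<and> Yden u \<noteq> 0 \<and> Yquad u \<noteq> 0 \<and> norm (Yfun u) < 1 / 16 \<and>
     norm (u ^ 5) < 1 / 16 \<and> apery_fun (u ^ 5) \<noteq> 0 \<and> Re (Ynum u / Yden u) > 0"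

lemma apery_fun_0 [simp]: "apery_fun 0 = 1"
  by (simp add: apery_fun_def apery_fps_def eval_fps_at_0)

lemma apery_log_0 [simp]: "apery_log 0 = 0"
  by (simp add: apery_log_def apery_log_fps_def eval_fps_at_0)

lemma Yregular_near_0: "\<exists>r>0. \<forall>u. norm u < r \<longrightarrow> Yregular u"
proof -
  have [simp]: "Ynum 0 = 1" "Yden 0 = 1" "Yquad 0 = 1" "Yfun 0 = 0"
    by (auto simp: Ynum_def Yden_def Yquad_def Yfun_def)
  have cont: "isCont Ynum 0" "isCont Yden 0" "isCont Yquad 0"
    unfolding Ynum_def Yden_def Yquad_def by (intro continuous_intros)+
  \<comment> \<open>Limits are taken along \<open>nhds 0\<close> rather than \<open>at 0\<close>, so
    that the origin itself is included.\<close>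
  have id: "((\<lambda>u. u) \<longlongrightarrow> 0) (nhds (0 :: complex))" by (rule filterlim_ident)
  have lim: "(Ynum \<longlongrightarrow> 1) (nhds 0)" "(Yden \<longlongrightarrow> 1) (nhds 0)" "(Yquad \<longlongrightarrow> 1) (nhds 0)"
    using cont[THEN isCont_tendsto_compose, OF id] by simp_all
  have "(Yfun \<longlongrightarrow> 0 * 1 / 1) (nhds 0)"
    unfolding Yfun_eq [abs_def] by (intro tendsto_intros lim id) auto
  then have Y: "((\<lambda>u. norm (Yfun u)) \<longlongrightarrow> 0) (nhds 0)"
    using tendsto_norm by fastforce
  have pow: "((\<lambda>u :: complex. u ^ 5) \<longlongrightarrow> 0) (nhds 0)"
    using tendsto_power[OF id, of 5] by simp
  then have pow': "((\<lambda>u :: complex. norm (u ^ 5)) \<longlongrightarrow> 0) (nhds 0)"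
    using tendsto_norm by fastforce
  have "isCont apery_fun 0"
    using has_field_derivative_apery_fun[of 0] by (intro DERIV_isCont) auto
  from isCont_tendsto_compose[OF this pow] have f: "((\<lambda>u. apery_fun (u ^ 5)) \<longlongrightarrow> 1) (nhds 0)"
    by simp
  have "((\<lambda>u. Re (Ynum u / Yden u)) \<longlongrightarrow> Re (1 / 1)) (nhds 0)"
    by (intro tendsto_intros lim) auto
  then have R: "((\<lambda>u. Re (Ynum u / Yden u)) \<longlongrightarrow> 1) (nhds 0)"
    by simp
  have "eventually Yregular (nhds 0)"
    unfolding Yregular_def [abs_def]
    by (intro eventually_conj tendsto_imp_eventually_ne[OF lim(1)] tendsto_imp_eventually_ne[OF lim(2)]
        tendsto_imp_eventually_ne[OF lim(3)] tendsto_imp_eventually_ne[OF f] order_tendstoD(2)[OF Y] order_tendstoD(2)[OF pow']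
        order_tendstoD(1)[OF R]) auto
  then show ?thesis
    by (auto simp: eventually_nhds_metric)
qed

section \<open>Chain rules along \<open>Y(u)\<close> and \<open>u^5\<close>\<close>

lemma has_field_derivative_apery_fun_Yfun:
  assumes "Yregular u"
  shows "((\<lambda>u. apery_fun (Yfun u)) has_field_derivative
           apery_fun' (Yfun u) * (Yquad u ^ 4 / Yden u ^ 2)) (at u)"
  using assms by (intro DERIV_chain2[OF has_field_derivative_apery_fun has_field_derivative_Yfun])
                 (auto simp: Yregular_def)

lemma has_field_derivative_apery_flux_Yfun:
  assumes "Yregular u"
  shows "((\<lambda>u. apery_flux (Yfun u)) has_field_derivative
           (3 + Yfun u) * apery_fun (Yfun u) * (Yquad u ^ 4 / Yden u ^ 2)) (at u)"
  using assms by (intro DERIV_chain2[OF has_field_derivative_apery_flux has_field_derivative_Yfun])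
                 (auto simp: Yregular_def)

lemma has_field_derivative_apery_fun_power5:
  assumes "Yregular u"
  shows "((\<lambda>u. apery_fun (u ^ 5)) has_field_derivative apery_fun' (u ^ 5) * (5 * u ^ 4)) (at u)"
  using assms by (intro DERIV_chain2[OF has_field_derivative_apery_fun])
                 (auto simp: Yregular_def intro!: derivative_eq_intros)

lemma has_field_derivative_apery_flux_power5:
  assumes "Yregular u"
  shows "((\<lambda>u. apery_flux (u ^ 5)) has_field_derivative (3 + u ^ 5) * apery_fun (u ^ 5) * (5 * u ^ 4)) (at u)"
  using assms by (intro DERIV_chain2[OF has_field_derivative_apery_flux])
                 (auto simp: Yregular_def intro!: derivative_eq_intros)

lemma has_field_derivative_apery_log_power5:
  assumes "Yregular u"
  shows "((\<lambda>u. apery_log (u ^ 5)) has_field_derivative apery_log' (u ^ 5) * (5 * u ^ 4)) (at u)"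
  using assms by (intro DERIV_chain2[OF has_field_derivative_apery_log])
                 (auto simp: Yregular_def intro!: derivative_eq_intros)

text \<open>
  \<open>pulled_fun\<close> is the pullback \<open>f(Y) / D\<close>, and \<open>pulled_flux\<close> is
  \<open>(1 - 11 u\<^sup>5 - u\<^sup>1\<^sup>0) u\<close> times its derivative, written through the flux of \<open>f\<close> so that
  no second derivative of \<open>f\<close> is needed.
\<close>
definition pulled_fun :: "complex \<Rightarrow> complex" where
  "pulled_fun u = apery_fun (Yfun u) / Yden u"

definition pulled_fun' :: "complex \<Rightarrow> complex" where
  "pulled_fun' u = apery_fun' (Yfun u) * Yquad u ^ 4 / Yden u ^ 3 - apery_fun (Yfun u) * Yden' u / Yden u ^ 2"

definition pulled_flux :: "complex \<Rightarrow> complex" where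
  "pulled_flux u = Yden u * apery_flux (Yfun u)
                     - apery_fun (Yfun u) * (Yquad u * Ynum u * u * Yden' u / Yden u)"

lemma has_field_derivative_pulled_fun:
  assumes "Yregular u"
  shows "(pulled_fun has_field_derivative pulled_fun' u) (at u)"
proof -
  have D: "Yden u \<noteq> 0" using assms by (simp add: Yregular_def)
  show ?thesis
    unfolding pulled_fun_def [abs_def]
    by (rule DERIV_cong[OF DERIV_divide[OF has_field_derivative_apery_fun_Yfun[OF assms] has_field_derivative_Yden D]])
       (use D in \<open>simp add: pulled_fun'_def field_simps eval_nat_numeral\<close>)
qed

lemma pulled_flux_eq:
  assumes "Yregular u"
  shows "pulled_flux u = (1 - 11 * u ^ 5 - (u ^ 5) ^ 2) * u * pulled_fun' u"
proof -
  have D: "Yden u \<noteq> 0" using assms by (simp add: Yregular_def)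
  show ?thesis
    unfolding pulled_flux_def pulled_fun'_def Yquad_Ynum_Yden [symmetric] apery_flux_def Yfun_discriminant[OF D]
    using D by (simp add: Yfun_eq divide_simps) (simp add: algebra_simps eval_nat_numeral)
qed

text \<open>For \<open>f(u^5)\<close> the corresponding flux is
  \<open>5 * apery_flux (u ^ 5)\<close>, with derivative \<open>25 u^4 (3 + u^5) f(u^5)\<close>;
  hence both functions obey one equation.\<close>

lemma has_field_derivative_pulled_flux:
  assumes "Yregular u"
  shows "(pulled_flux has_field_derivative 25 * u ^ 4 * (3 + u ^ 5) * pulled_fun u) (at u)"
proof -
  have D: "Yden u \<noteq> 0" using assms by (simp add: Yregular_def)
  define g where "g u = Yquad u * Ynum u * u * Yden' u" for u
  define g' where "g' = (-1 - 2 * u) * Ynum u * u * Yden' u + Yquad u * (-2 + 8 * u - 9 * u ^ 2 + 4 * u ^ 3) * u * Yden' u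
      + Yquad u * Ynum u * Yden' u + Yquad u * Ynum u * u * (8 + 12 * u + 12 * u ^ 2)"
  have g: "(g has_field_derivative g') (at u)"
    unfolding g_def [abs_def] g'_def Yquad_def [abs_def] Ynum_def [abs_def] Yden'_def [abs_def]
    by (rule derivative_eq_intros refl)+ (simp, algebra)
  have "(pulled_flux has_field_derivative
     Yden' u * apery_flux (Yfun u) + (3 + Yfun u) * apery_fun (Yfun u) * (Yquad u ^ 4 / Yden u ^ 2) * Yden u
     - (apery_fun' (Yfun u) * (Yquad u ^ 4 / Yden u ^ 2) * (g u / Yden u) +
        (g' * Yden u - g u * Yden' u) / (Yden u * Yden u) * apery_fun (Yfun u))) (at u)"
    unfolding pulled_flux_def [abs_def] g_def[symmetric]
    by (intro DERIV_diff DERIV_mult has_field_derivative_Yden DERIV_divide g D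
        has_field_derivative_apery_fun_Yfun has_field_derivative_apery_flux_Yfun assms)
  also have "Yden' u * apery_flux (Yfun u) + (3 + Yfun u) * apery_fun (Yfun u) * (Yquad u ^ 4 / Yden u ^ 2) * Yden u
     - (apery_fun' (Yfun u) * (Yquad u ^ 4 / Yden u ^ 2) * (g u / Yden u) +
        (g' * Yden u - g u * Yden' u) / (Yden u * Yden u) * apery_fun (Yfun u))
     = apery_fun (Yfun u) * (Yquad u ^ 4 * (3 * Yden u + u * Ynum u) - (g' * Yden u - g u * Yden' u)) / Yden u ^ 2"
  proof -
    \<comment> \<open>The two terms with \<open>f'(Y)\<close> cancel; only multiples of
      \<open>f(Y)\<close> remain.\<close>
    have "Yden' u * apery_flux (Yfun u) = apery_fun' (Yfun u) * (Yquad u ^ 4 / Yden u ^ 2) * (g u / Yden u)"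
      unfolding apery_flux_def Yfun_discriminant[OF D] g_def
      using D by (simp add: Yfun_eq eval_nat_numeral)
    moreover have "(3 + Yfun u) * apery_fun (Yfun u) * (Yquad u ^ 4 / Yden u ^ 2) * Yden u
                   = apery_fun (Yfun u) * (Yquad u ^ 4 * (3 * Yden u + u * Ynum u)) / Yden u ^ 2"
    proof -
      have "3 + Yfun u = (3 * Yden u + u * Ynum u) / Yden u"
        using D by (simp add: Yfun_eq field_simps)
      then show ?thesis using D by (simp add: power2_eq_square)
    qed
    ultimately show ?thesis
      by (simp add: power2_eq_square algebra_simps diff_divide_distrib add_divide_distrib)
  qed
  \<comment> \<open>Here the special form of \<open>Y\<close> enters: the bracket is
    \<open>D\<close> times the coefficient in the equation for \<open>f(u^5)\<close>.\<close>
  also have "Yquad u ^ 4 * (3 * Yden u + u * Ynum u) - (g' * Yden u - g u * Yden' u) = 25 * u ^ 4 * (3 + u ^ 5) * Yden u"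
    unfolding g'_def g_def Yquad_def Ynum_def Yden_def Yden'_def by algebra
  also have "apery_fun (Yfun u) * (25 * u ^ 4 * (3 + u ^ 5) * Yden u) / Yden u ^ 2 = 25 * u ^ 4 * (3 + u ^ 5) * pulled_fun u"
    using D by (simp add: pulled_fun_def power2_eq_square)
  finally show ?thesis .
qed

text \<open>Taking \<open>K = {0}\<close> covers the cases where the derivative is known to vanish
  only after multiplication by a factor that is zero at the origin.\<close>

lemma has_field_derivative_zero_constant_on_convex:
  fixes f :: "complex \<Rightarrow> complex"
  assumes "convex S" "finite K" "continuous_on S f" "x \<in> S" "c \<in> S"
    and deriv: "\<And>x. x \<in> S - K \<Longrightarrow> (f has_field_derivative 0) (at x)"
  shows "f x = f c"
proof (rule has_derivative_zero_unique_strong_convex[OF assms(1-3) assms(5) refl _ assms(4)])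
  show "(f has_derivative (\<lambda>h. 0)) (at x within S)" if "x \<in> S - K" for x
    using has_field_derivative_at_within[OF deriv[OF that]]
    unfolding has_field_derivative_def lambda_zero .
qed

lemma apery_modular_equation:
  assumes "\<And>u. norm u < r \<Longrightarrow> Yregular u" and u: "norm u < r"
  shows "apery_fun (Yfun u) = Yden u * apery_fun (u ^ 5)"
proof -
  have reg: "Yregular v" if "v \<in> ball 0 r" for v using that assms(1) by simp
  have u: "u \<in> ball 0 r" using u by simp
  have "r > 0" using u norm_ge_zero[of u] by (simp del: norm_ge_zero)
  \<comment> \<open>The Wronskian of \<open>f(Y) / D\<close> and \<open>f(u\<^sup>5)\<close>, scaled by \<open>(1 - 11 u\<^sup>5 - u\<^sup>1\<^sup>0) u\<close>.\<close>
  define W where "W u = apery_fun (u ^ 5) * pulled_flux u - 5 * (pulled_fun u * apery_flux (u ^ 5))" for u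
  have W': "(W has_field_derivative 0) (at v)" if "v \<in> ball 0 r" for v
  proof -
    note * = reg[OF that]
    have "(W has_field_derivative
        (apery_fun' (v ^ 5) * (5 * v ^ 4) * pulled_flux v + 25 * v ^ 4 * (3 + v ^ 5) * pulled_fun v * apery_fun (v ^ 5))
        - 5 * (pulled_fun' v * apery_flux (v ^ 5) + (3 + v ^ 5) * apery_fun (v ^ 5) * (5 * v ^ 4) * pulled_fun v)) (at v)"
      unfolding W_def [abs_def]
      by (intro DERIV_diff DERIV_mult DERIV_cmult has_field_derivative_pulled_fun has_field_derivative_pulled_flux
          has_field_derivative_apery_fun_power5 has_field_derivative_apery_flux_power5 *)
    \<comment> \<open>The terms with derivatives of \<open>f(v^5)\<close> and of the pullback cancel
      by \<open>pulled_flux_eq\<close>, the others because the two equations agree.\<close>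
    also have "(apery_fun' (v ^ 5) * (5 * v ^ 4) * pulled_flux v + 25 * v ^ 4 * (3 + v ^ 5) * pulled_fun v * apery_fun (v ^ 5))
        - 5 * (pulled_fun' v * apery_flux (v ^ 5) + (3 + v ^ 5) * apery_fun (v ^ 5) * (5 * v ^ 4) * pulled_fun v) = 0"
      unfolding pulled_flux_eq[OF *] apery_flux_def by (simp add: algebra_simps eval_nat_numeral)
    finally show ?thesis .
  qed
  have W0: "W v = 0" if "v \<in> ball 0 r" for v
  proof -
    have "W v = W 0"
      by (rule has_field_derivative_zero_constant_on_convex[of "ball 0 r" "{}" W v 0])
         (use that \<open>r > 0\<close> W' in \<open>auto intro!: continuous_at_imp_continuous_on DERIV_isCont[OF W']\<close>)
    \<comment> \<open>Both fluxes vanish at the origin.\<close>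
    also have "\<dots> = 0"
      by (simp add: W_def pulled_flux_def apery_flux_def Yfun_def)
    finally show ?thesis .
  qed
  define q where "q u = pulled_fun u / apery_fun (u ^ 5)" for u
  have q': "(q has_field_derivative (pulled_fun' v * apery_fun (v ^ 5) - pulled_fun v * (apery_fun' (v ^ 5) * (5 * v ^ 4)))
        / (apery_fun (v ^ 5) * apery_fun (v ^ 5))) (at v)" if "v \<in> ball 0 r" for v
  proof -
    note * = reg[OF that]
    show ?thesis unfolding q_def [abs_def]
      by (intro DERIV_divide has_field_derivative_pulled_fun has_field_derivative_apery_fun_power5 *)
         (use * in \<open>simp add: Yregular_def\<close>)
  qed
  have "q u = q 0"
  proof (rule has_field_derivative_zero_constant_on_convex[of "ball 0 r" "{0}" q u 0])
    show "continuous_on (ball 0 r) q"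
      by (intro continuous_at_imp_continuous_on ballI DERIV_isCont[OF q'])
    \<comment> \<open>Away from the origin the scaling factor of \<open>W\<close> can be
      cancelled.\<close>
    show "(q has_field_derivative 0) (at v)" if "v \<in> ball 0 r - {0}" for v
    proof -
      have *: "Yregular v" and v: "v \<in> ball 0 r" "v \<noteq> 0" using reg that by auto
      have "(1 - 11 * v ^ 5 - (v ^ 5) ^ 2) * v \<noteq> 0"
        unfolding Yquad_Ynum_Yden[symmetric] using * v by (simp add: Yregular_def)
      moreover have "(1 - 11 * v ^ 5 - (v ^ 5) ^ 2) * v *
          (pulled_fun' v * apery_fun (v ^ 5) - pulled_fun v * (apery_fun' (v ^ 5) * (5 * v ^ 4))) = W v"
        unfolding W_def pulled_flux_eq[OF *] apery_flux_def by (simp add: algebra_simps eval_nat_numeral)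
      ultimately have "pulled_fun' v * apery_fun (v ^ 5) - pulled_fun v * (apery_fun' (v ^ 5) * (5 * v ^ 4)) = 0"
        using W0[OF v(1)] by simp
      then show ?thesis
        using q'[OF v(1)] by simp
    qed
  qed (use u \<open>r > 0\<close> in auto)
  also have "q 0 = 1"
    by (simp add: q_def pulled_fun_def Yfun_def Yden_def)
  finally show ?thesis
    using reg[OF u] by (simp add: q_def pulled_fun_def Yregular_def field_simps)
qed

section \<open>Averaging over the fifth roots of unity\<close>

text \<open>The quotient is \<open>Y(v) / v\<close> with the singularity removed, so near
  \<open>0\<close> this is holomorphic; for small \<open>v \<noteq> 0\<close> its real part is
  \<open>- r(Y(v)) - log |v|\<close>.\<close>

definition log_branch :: "complex \<Rightarrow> complex" where
  "log_branch v = Ln (Ynum v / Yden v) + apery_log (Yfun v)"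

text \<open>Since \<open>v Y' / Y = E^4 / (N D)\<close>, the two summands give
  \<open>E^4 / (N D) - 1\<close> and \<open>(f(Y) - 1) E^4 / (N D)\<close>; the modular equation
  then removes \<open>D\<close>.\<close>

lemma has_field_derivative_log_branch:
  assumes r: "\<And>u. norm u < r \<Longrightarrow> Yregular u" and v: "norm v < r"
  shows "\<exists>d. (log_branch has_field_derivative d) (at v) \<and>
             v * d = Yquad v ^ 4 / Ynum v * apery_fun (v ^ 5) - 1"
proof -
  note reg = r[OF v]
  have nz: "Yden v \<noteq> 0" "Ynum v \<noteq> 0" and Y: "norm (Yfun v) < 1 / 16"
    using reg by (auto simp: Yregular_def)
  have pos: "Ynum v / Yden v \<notin> \<real>\<^sub>\<le>\<^sub>0"
    using reg by (auto simp: Yregular_def complex_nonpos_Reals_iff)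
  define d1 where "d1 = ((-2 + 8 * v - 9 * v ^ 2 + 4 * v ^ 3) * Yden v - Ynum v * Yden' v) / Yden v ^ 2"
  define d where "d = inverse (Ynum v / Yden v) * d1 + apery_log' (Yfun v) * (Yquad v ^ 4 / Yden v ^ 2)"
  have "(log_branch has_field_derivative d) (at v)"
    unfolding log_branch_def [abs_def] d_def d1_def
    by (intro DERIV_add DERIV_chain2[OF has_field_derivative_Ln[OF pos] has_field_derivative_Ynum_over_Yden[OF nz(1)]]
        DERIV_chain2[OF has_field_derivative_apery_log[OF Y] has_field_derivative_Yfun[OF nz(1)]])
  moreover have "v * d = Yquad v ^ 4 / Ynum v * apery_fun (v ^ 5) - 1"
  proof -
    have "v * ((-2 + 8 * v - 9 * v ^ 2 + 4 * v ^ 3) * Yden v - Ynum v * Yden' v) = Yquad v ^ 4 - Ynum v * Yden v"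
      unfolding Yquad_def Ynum_def Yden_def Yden'_def by algebra
    then have "v * d1 = (Yquad v ^ 4 - Ynum v * Yden v) / Yden v ^ 2"
      by (simp add: d1_def)
    then have 1: "inverse (Ynum v / Yden v) * (v * d1) = Yquad v ^ 4 / (Ynum v * Yden v) - 1"
      using nz by (simp add: field_simps power2_eq_square)
    \<comment> \<open>Trading \<open>v\<close> for \<open>Y\<close> makes
      \<open>apery_log'_eq\<close> applicable.\<close>
    have "v = Yfun v * (Yden v / Ynum v)"
      using nz by (simp add: Yfun_eq)
    then have "v * (apery_log' (Yfun v) * (Yquad v ^ 4 / Yden v ^ 2))
        = (Yfun v * apery_log' (Yfun v)) * ((Yden v / Ynum v) * (Yquad v ^ 4 / Yden v ^ 2))"
      by (metis mult.assoc mult.commute)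
    also have "\<dots> = (apery_fun (Yfun v) - 1) * (Yquad v ^ 4 / (Ynum v * Yden v))"
      using nz apery_log'_eq[OF Y] by (simp add: power2_eq_square)
    also have "\<dots> = Yquad v ^ 4 / Ynum v * apery_fun (v ^ 5) - Yquad v ^ 4 / (Ynum v * Yden v)"
      using nz apery_modular_equation[OF r v] by (simp add: algebra_simps diff_divide_distrib)
    finally have 2: "v * (apery_log' (Yfun v) * (Yquad v ^ 4 / Yden v ^ 2))
        = Yquad v ^ 4 / Ynum v * apery_fun (v ^ 5) - Yquad v ^ 4 / (Ynum v * Yden v)" .
    have "v * d = inverse (Ynum v / Yden v) * (v * d1) + v * (apery_log' (Yfun v) * (Yquad v ^ 4 / Yden v ^ 2))"
      unfolding d_def by (simp only: distrib_left mult_ac)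
    then show ?thesis unfolding 1 2 by simp
  qed
  ultimately show ?thesis by blast
qed

section \<open>Sums over the fifth roots of unity\<close>

lemma zeta5_power5: "zeta5 ^ 5 = 1"
  by (simp add: zeta5_def Complex.DeMoivre)

lemma zeta5_neq_1: "zeta5 \<noteq> 1"
proof
  assume "zeta5 = 1"
  then have "cos (2 * pi / 5) = 1" by (simp add: zeta5_def complex_eq_iff)
  moreover have "cos (2 * pi / 5) < cos 0"
    by (intro cos_monotone_0_pi) auto
  ultimately show False by simp
qed

lemma norm_zeta5 [simp]: "norm zeta5 = 1"
  by (simp add: zeta5_def)

lemma sum_Yquad_power5_Yden:
  "(\<Sum>j = 0..4::nat. Yquad (zeta5 ^ j * u) ^ 5 * Yden (zeta5 ^ j * u)) = 5 * (1 - 11 * u ^ 5 - (u ^ 5) ^ 2)"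
proof -
  have "(zeta5 - 1) * (1 + zeta5 + zeta5 ^ 2 + zeta5 ^ 3 + zeta5 ^ 4) = 0"
    using zeta5_power5 by algebra
  then have z: "1 + zeta5 + zeta5 ^ 2 + zeta5 ^ 3 + zeta5 ^ 4 = 0"
    using zeta5_neq_1 by simp
  \<comment> \<open>The relation \<open>z\<close> with \<open>zeta5\<close> replaced by its second,
    third and fourth powers.\<close>
  have z2: "1 + zeta5 ^ 2 + zeta5 ^ 4 + zeta5 ^ 6 + zeta5 ^ 8 = 0"
    and z3: "1 + zeta5 ^ 3 + zeta5 ^ 6 + zeta5 ^ 9 + zeta5 ^ 12 = 0"
    and z4: "1 + zeta5 ^ 4 + zeta5 ^ 8 + zeta5 ^ 12 + zeta5 ^ 16 = 0"
    using z zeta5_power5 by algebra+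
  define w where "w j = zeta5 ^ j * u" for j :: nat
  have sum5: "(\<Sum>j = 0..4::nat. f j) = f 0 + f 1 + f 2 + f 3 + f 4" for f :: "nat \<Rightarrow> complex"
    by (simp add: eval_nat_numeral)
  have pw: "(\<Sum>j = 0..4. w j ^ k) = (if 5 dvd k then 5 * u ^ k else 0)" for k
  proof -
    have "(\<Sum>j = 0..4. w j ^ k) = (\<Sum>j = 0..4::nat. (zeta5 ^ k) ^ j) * u ^ k"
      by (simp add: w_def power_mult_distrib sum_distrib_left mult.commute flip: power_mult)
    also have "(\<Sum>j = 0..4::nat. (zeta5 ^ k) ^ j) = (if 5 dvd k then 5 else 0)"
    proof -
      have "zeta5 ^ k = zeta5 ^ (k mod 5)"
      proof -
        have "zeta5 ^ k = zeta5 ^ (5 * (k div 5) + k mod 5)" by simp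
        also have "\<dots> = zeta5 ^ (k mod 5)"
          unfolding power_add power_mult zeta5_power5 by simp
        finally show ?thesis .
      qed
      moreover have "k mod 5 \<in> {0, 1, 2, 3, 4}" by auto
      ultimately show ?thesis
        unfolding sum5 dvd_eq_mod_eq_0 using z z2 z3 z4
        by (elim insertE emptyE; simp flip: power_mult)
    qed
    finally show ?thesis by simp
  qed
  \<comment> \<open>Only the coefficients \<open>1\<close>, \<open>-11\<close>, \<open>-1\<close> in
    degrees \<open>0\<close>, \<open>5\<close>, \<open>10\<close> survive; writing
    \<open>v ^ 1\<close> lets \<open>pw\<close> apply to the linear term.\<close>
  have expand: "Yquad v ^ 5 * Yden v = 1 - 2 * v ^ 1 - 6 * v ^ 2 + 7 * v ^ 3 + 26 * v ^ 4 - 11 * v ^ 5 - 53 * v ^ 6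
      - 9 * v ^ 7 + 48 * v ^ 8 + 39 * v ^ 9 - v ^ 10 - 23 * v ^ 11 - 19 * v ^ 12 - 7 * v ^ 13 - v ^ 14" for v
    unfolding Yquad_def Yden_def by algebra
  have "(\<Sum>j = 0..4. Yquad (w j) ^ 5 * Yden (w j)) = 5 * (1 - 11 * u ^ 5 - (u ^ 5) ^ 2)"
    unfolding expand sum_subtractf sum.distrib sum_distrib_left[symmetric] pw
    by (simp add: algebra_simps flip: power_mult)
  then show ?thesis unfolding w_def .
qed

text \<open>Both sides vanish at \<open>0\<close>, and their logarithmic derivatives
  \<open>v d/dv\<close> agree.\<close>

lemma apery_log_decomposition:
  assumes r: "\<And>u. norm u < r \<Longrightarrow> Yregular u" and u: "norm u < r"
  shows "apery_log (u ^ 5) = (\<Sum>j = 0..4::nat. log_branch (zeta5 ^ j * u))"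
proof -
  have rot: "norm (zeta5 ^ j * v) < r" if "norm v < r" for v j
    using that by (simp add: norm_mult norm_power)
  have "r > 0" using u norm_ge_zero[of u] by linarith
  define \<Phi> where "\<Phi> v = apery_log (v ^ 5) - (\<Sum>j = 0..4::nat. log_branch (zeta5 ^ j * v))" for v
  have deriv: "\<exists>d. (\<Phi> has_field_derivative d) (at v) \<and> v * d = 0" if v: "norm v < r" for v
  proof -
    from has_field_derivative_log_branch[OF r] obtain d where d: "norm v < r \<Longrightarrow> (log_branch has_field_derivative d v) (at v)"
      "norm v < r \<Longrightarrow> v * d v = Yquad v ^ 4 / Ynum v * apery_fun (v ^ 5) - 1" for v
      by metis
    have v5: "norm (v ^ 5) < 1 / 16" using r[OF v] by (simp add: Yregular_def)
    let ?d = "apery_log' (v ^ 5) * (5 * v ^ 4) - (\<Sum>j = 0..4::nat. d (zeta5 ^ j * v) * zeta5 ^ j)"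
    have rotd: "((\<lambda>v. log_branch (zeta5 ^ j * v)) has_field_derivative d (zeta5 ^ j * v) * zeta5 ^ j) (at v)" for j
      by (rule DERIV_chain2[where g = "\<lambda>v. zeta5 ^ j * v", OF d(1)[OF rot[OF v]]])
         (auto intro!: derivative_eq_intros)
    have "(\<Phi> has_field_derivative ?d) (at v)"
      unfolding \<Phi>_def [abs_def]
      by (intro DERIV_diff has_field_derivative_apery_log_power5 DERIV_sum r v rotd)
    moreover have "v * ?d = 0"
    proof -
      have "v * (\<Sum>j = 0..4::nat. d (zeta5 ^ j * v) * zeta5 ^ j) = (\<Sum>j = 0..4::nat. (zeta5 ^ j * v) * d (zeta5 ^ j * v))"
        by (simp add: sum_distrib_left mult_ac)
      also have "\<dots> = (\<Sum>j = 0..4::nat. Yquad (zeta5 ^ j * v) ^ 5 * Yden (zeta5 ^ j * v)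
                           * (apery_fun (v ^ 5) / (1 - 11 * v ^ 5 - (v ^ 5) ^ 2)) - 1)"
      proof (intro sum.cong refl)
        fix j :: nat
        let ?w = "zeta5 ^ j * v"
        have w5: "?w ^ 5 = v ^ 5"
        proof -
          have "(zeta5 ^ j) ^ 5 = (zeta5 ^ 5) ^ j"
            by (simp only: power_mult[symmetric] mult.commute)
          then show ?thesis by (simp add: power_mult_distrib zeta5_power5)
        qed
        have nz: "Ynum ?w \<noteq> 0" "Yden ?w \<noteq> 0" "Yquad ?w \<noteq> 0"
          using r[OF rot[OF v]] by (auto simp: Yregular_def)
        have "?w * d ?w = Yquad ?w ^ 4 / Ynum ?w * apery_fun (v ^ 5) - 1"
          using d(2)[OF rot[OF v], of j] unfolding w5 .
        \<comment> \<open>Extending by \<open>E D\<close> makes the denominator a function of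
          \<open>v^5\<close>, common to all five rotations.\<close>
        also have "Yquad ?w ^ 4 / Ynum ?w = Yquad ?w ^ 5 * Yden ?w / (Yquad ?w * Ynum ?w * Yden ?w)"
          using nz by (simp add: eval_nat_numeral)
        also have "Yquad ?w * Ynum ?w * Yden ?w = 1 - 11 * v ^ 5 - (v ^ 5) ^ 2"
          unfolding Yquad_Ynum_Yden w5 ..
        finally show "?w * d ?w = Yquad ?w ^ 5 * Yden ?w * (apery_fun (v ^ 5) / (1 - 11 * v ^ 5 - (v ^ 5) ^ 2)) - 1"
          by simp
      qed
      also have "\<dots> = 5 * (1 - 11 * v ^ 5 - (v ^ 5) ^ 2) * (apery_fun (v ^ 5) / (1 - 11 * v ^ 5 - (v ^ 5) ^ 2)) - 5"
        unfolding sum_subtractf sum_distrib_right[symmetric] sum_Yquad_power5_Yden by simp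
      also have "\<dots> = 5 * (apery_fun (v ^ 5) - 1)"
        using r[OF v] unfolding Yquad_Ynum_Yden[symmetric] by (simp add: Yregular_def)
      also have "\<dots> = v * (apery_log' (v ^ 5) * (5 * v ^ 4))"
        unfolding apery_log'_eq[OF v5, symmetric] by (simp add: eval_nat_numeral)
      finally show ?thesis
        unfolding right_diff_distrib by (simp only: diff_self)
    qed
    ultimately show ?thesis by blast
  qed
  have "\<Phi> u = \<Phi> 0"
  proof (rule has_field_derivative_zero_constant_on_convex[of "ball 0 r" "{0}" \<Phi> u 0])
    show "continuous_on (ball 0 r) \<Phi>"
      using deriv by (intro continuous_at_imp_continuous_on ballI) (auto intro: DERIV_isCont)
    show "(\<Phi> has_field_derivative 0) (at v)" if "v \<in> ball 0 r - {0}" for v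
      using deriv[of v] that by auto
  qed (use u \<open>r > 0\<close> in auto)
  also have "\<dots> = 0"
    by (simp add: \<Phi>_def log_branch_def Ynum_def Yden_def Yfun_def)
  finally show ?thesis by (simp add: \<Phi>_def)
qed

theorem mainTheorem9:
  shows "\<exists>\<epsilon>>0. \<forall>u::complex. 0 < cmod u \<and> cmod u < \<epsilon> \<longrightarrow>
           rfam (u ^ 5) = (\<Sum>j = 0..4::nat. rfam (Yfun (zeta5 ^ j * u)))"
proof -
  obtain r where "r > 0" and r: "\<And>u. norm u < r \<Longrightarrow> Yregular u"
    using Yregular_near_0 by blast
  have "rfam (u ^ 5) = (\<Sum>j = 0..4::nat. rfam (Yfun (zeta5 ^ j * u)))" if u: "0 < norm u" "norm u < r" for u
  proof -
    have branch: "rfam (Yfun (zeta5 ^ j * u)) = - ln (norm u) - Re (log_branch (zeta5 ^ j * u))" for j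
    proof -
      let ?w = "zeta5 ^ j * u"
      have w: "norm ?w = norm u" by (simp add: norm_mult norm_power)
      then have reg: "Yregular ?w" using r u by simp
      then have nz: "Ynum ?w \<noteq> 0" "Yden ?w \<noteq> 0" and Y: "norm (Yfun ?w) < 1 / 16" by (auto simp: Yregular_def)
      have eq: "Yfun ?w = ?w * (Ynum ?w / Yden ?w)" by (simp add: Yfun_eq)
      have "?w \<noteq> 0" using w u by (metis norm_zero less_irrefl)
      then have "Yfun ?w \<noteq> 0" using nz eq by simp
      then have "rfam (Yfun ?w) = - ln (norm (Yfun ?w)) - Re (apery_log (Yfun ?w))"
        using Y by (rule rfam_eq)
      \<comment> \<open>Moduli multiply, so the real logarithm splits without any choice of
        branch.\<close>
      also have "ln (norm (Yfun ?w)) = ln (norm u) + ln (norm (Ynum ?w / Yden ?w))"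
        unfolding eq norm_mult[of ?w] w using u nz by (subst ln_mult) auto
      also have "ln (norm (Ynum ?w / Yden ?w)) = Re (Ln (Ynum ?w / Yden ?w))"
        using nz by simp
      finally show ?thesis by (simp add: log_branch_def)
    qed
    have "rfam (u ^ 5) = - ln (norm (u ^ 5)) - Re (apery_log (u ^ 5))"
      using r[OF u(2)] u by (intro rfam_eq) (auto simp: Yregular_def)
    \<comment> \<open>The factor \<open>5\<close> matches the copies of \<open>log |u|\<close> from
      the five rotated arguments.\<close>
    also have "ln (norm (u ^ 5)) = 5 * ln (norm u)"
      using u by (simp add: norm_power ln_realpow)
    also have "apery_log (u ^ 5) = (\<Sum>j = 0..4::nat. log_branch (zeta5 ^ j * u))"
      using r u(2) by (rule apery_log_decomposition)
    also have "- (5 * ln (norm u)) - Re (\<Sum>j = 0..4::nat. log_branch (zeta5 ^ j * u))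
        = (\<Sum>j = 0..4::nat. rfam (Yfun (zeta5 ^ j * u)))"
      unfolding branch sum_subtractf Re_sum by simp
    finally show ?thesis .
  qed
  with \<open>r > 0\<close> show ?thesis by blast
qed

end
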